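(* Let $X$ be a real vector space ordered by a cone $K$. 1. For $x,y\in K$ and $\lambda,\mu>0$: (i) $\sigma(\lambda x,\lambda y)=\sigma(x,y)$, and so $d(\lambda x,\lambda y)=d(x,y)$; (ii) $\sigma(\lambda x,\mu x)=\big[\,|\ln(\lambda/\mu)|,\infty\big)$, and so $d(\lambda x,\mu x)=|\ln(\lambda/\mu)|$; (iii) if $\mu x\le y\le\lambda x$ for some $\lambda,\mu>0$, then $d(x,y)\le\ln\max\{\mu^{-1},\lambda\}$. 2. Let $x,y,x',y'\in K$. If $\sigma(x,y)\subset\sigma(x',y')$, then $d(x,y)\ge d(x',y')$. The converse is true if the order is Archimedean. Also $$\max\{d(x,y),d(x',y')\}=\inf[\sigma(x,y)\cap\sigma(x',y')].$$ 3. For $x,y,x',y'\in K$ the following monotonicity inequalities hold: (i) $x\le x'$ and $y'\le y$ imply $d(x',x'+y')\le d(x,x+y)$; (ii) $x\le x'\le y'\le y$ implies $d(x',y')\le d(x,y)$. 4. For all $x,y,x',y'\in K$ and $\lambda,\mu>0$, $$d(\lambda x+\mu y,\lambda x'+\mu y')\le\max\{d(x,x'),d(y,y')\}.$$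
   Context: A cone $K$ in a real vector space $X$ is a nonempty subset with $K+K\subset K$, $tK\subset K$ for all $t\ge 0$, and $K\cap(-K)=\{0\}$; it induces the order $x\le y\iff y-x\in K$. The order is Archimedean if, for all $x,y\in X$, ($nx\le y$ for all $n\in\mathbb{N}$) implies $x\le 0$. For $x,y\in K$, $\sigma(x,y)=\{s\ge 0: e^{-s}x\le y\le e^{s}x\}$, and the Thompson metric is $d(x,y)=\inf\sigma(x,y)\in[0,\infty]$, with $\inf\emptyset=\infty$.
   Formalization: In 1(ii) and 1(iii) it is additionally assumed that x ≠ 0: since σ(0,0)=[0,∞) and d(0,0)=0, 1(ii) fails for x=0, λ≠μ, and 1(iii) fails for x=y=0, λ<1<μ. *)

theory Defs
  imports Complex_Main "HOL-Library.Extended_Real"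
begin

definition ordering_cone :: "'a::real_vector set \<Rightarrow> bool" where
  "ordering_cone K \<longleftrightarrow>
     K \<noteq> {} \<and>
     (\<forall>x\<in>K. \<forall>y\<in>K. x + y \<in> K) \<and>
     (\<forall>t\<ge>0. \<forall>x\<in>K. t *\<^sub>R x \<in> K) \<and>
     K \<inter> uminus ` K = {0}"

definition cone_le :: "'a::real_vector \<Rightarrow> 'a set \<Rightarrow> 'a \<Rightarrow> bool"
    ("(_/ \<le>\<^bsub>_\<^esub> _)" [51, 0, 51] 50) where
  "x \<le>\<^bsub>K\<^esub> y \<longleftrightarrow> y - x \<in> K"

text \<open>Whether \<open>n\<close> starts at 0 or at 1 is immaterial: if \<open>n x \<le> y\<close> for all
  \<open>n \<ge> 1\<close>, then \<open>n x \<le> y - x\<close> for all \<open>n \<ge> 0\<close>.\<close>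

definition archimedean_cone :: "'a::real_vector set \<Rightarrow> bool" where
  "archimedean_cone K \<longleftrightarrow>
     (\<forall>x y. (\<forall>n::nat. real n *\<^sub>R x \<le>\<^bsub>K\<^esub> y) \<longrightarrow> x \<le>\<^bsub>K\<^esub> 0)"

definition thompson_set :: "'a::real_vector set \<Rightarrow> 'a \<Rightarrow> 'a \<Rightarrow> real set" where
  "thompson_set K x y =
     {s. 0 \<le> s \<and> exp (- s) *\<^sub>R x \<le>\<^bsub>K\<^esub> y \<and> y \<le>\<^bsub>K\<^esub> exp s *\<^sub>R x}"

text \<open>The infimum is taken in the extended reals, so that it is \<open>\<infinity>\<close> on the empty set.
  The type \<open>ereal\<close> is used instead of \<open>ennreal\<close> because the coercion from the reals to
  \<open>ennreal\<close> would truncate negative logarithms to 0.\<close>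

definition thompson_dist :: "'a::real_vector set \<Rightarrow> 'a \<Rightarrow> 'a \<Rightarrow> ereal" where
  "thompson_dist K x y = (INF s\<in>thompson_set K x y. ereal s)"

end

theory Submission
  imports Defs
begin

text \<open>Everything rests on the symmetric description \<open>s \<in> \<sigma>(x, y)\<close> iff \<open>s \<ge> 0\<close>,
  \<open>e\<^sup>s y - x \<in> K\<close> and \<open>e\<^sup>s x - y \<in> K\<close>. It shows that \<open>\<sigma>(x, y)\<close> is upward closed, which gives
  the formula for the maximum of two distances; the remaining inequalities reduce to inclusions of
  the sets \<open>\<sigma>\<close>, obtained by writing the required vectors as nonnegative combinations of elements
  of \<open>K\<close>. The Archimedean property says that \<open>K\<close> is closed along rays, so that \<open>\<sigma>(x, y)\<close> contains
  its infimum.\<close>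

section \<open>Passing from the sets \<sigma> to their infima\<close>

lemma thompson_dist_mono:
  "thompson_set K x y \<subseteq> thompson_set K x' y' \<Longrightarrow> thompson_dist K x' y' \<le> thompson_dist K x y"
  unfolding thompson_dist_def by (rule INF_superset_mono) auto

lemma thompson_dist_le: "s \<in> thompson_set K x y \<Longrightarrow> thompson_dist K x y \<le> ereal s"
  unfolding thompson_dist_def by (rule INF_lower)

context
  fixes K :: "'a::real_vector set"
  assumes K: "ordering_cone K"
begin

section \<open>Cone arithmetic and membership in \<sigma>\<close>

lemma cone_add: "x \<in> K \<Longrightarrow> y \<in> K \<Longrightarrow> x + y \<in> K"
  using K by (simp add: ordering_cone_def)

lemma cone_scale: "0 \<le> t \<Longrightarrow> x \<in> K \<Longrightarrow> t *\<^sub>R x \<in> K"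
  using K by (simp add: ordering_cone_def)

lemma cone_scale_iff:
  assumes "0 < t"
  shows "t *\<^sub>R x \<in> K \<longleftrightarrow> x \<in> K"
proof
  assume "t *\<^sub>R x \<in> K"
  then have "inverse t *\<^sub>R t *\<^sub>R x \<in> K"
    using assms by (simp add: cone_scale del: scaleR_scaleR)
  then show "x \<in> K"
    using assms by simp
qed (use assms cone_scale in auto)

lemma cone_ray_iff:
  assumes "x \<in> K" "x \<noteq> 0"
  shows "c *\<^sub>R x \<in> K \<longleftrightarrow> 0 \<le> c"
proof
  assume c: "c *\<^sub>R x \<in> K"
  show "0 \<le> c"
  proof (rule ccontr)
    assume "\<not> 0 \<le> c"
    then have "- x \<in> K"
      using c cone_scale_iff[of "- c" "- x"] by simp
    then have "x \<in> K \<inter> uminus ` K"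
      using assms by force
    then show False
      using K assms by (auto simp: ordering_cone_def)
  qed
qed (use assms cone_scale in auto)

lemma mem_thompson_set:
  "s \<in> thompson_set K x y \<longleftrightarrow> 0 \<le> s \<and> exp s *\<^sub>R y - x \<in> K \<and> exp s *\<^sub>R x - y \<in> K"
proof -
  have "exp s *\<^sub>R (y - exp (- s) *\<^sub>R x) = exp s *\<^sub>R y - x"
    by (simp add: scaleR_diff_right flip: exp_add)
  then show ?thesis
    using cone_scale_iff[of "exp s" "y - exp (- s) *\<^sub>R x"]
    by (auto simp: thompson_set_def cone_le_def)
qed

lemma thompson_set_upward:
  assumes "x \<in> K" "y \<in> K" "s \<in> thompson_set K x y" "s \<le> t"
  shows "t \<in> thompson_set K x y"
proof -
  have up: "exp t *\<^sub>R u - v \<in> K" if "exp s *\<^sub>R u - v \<in> K" "u \<in> K" for u v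
  proof -
    \<comment> \<open>Raising the exponent adds only a nonnegative multiple of
      \<open>u\<close>.\<close>
    have "(exp s *\<^sub>R u - v) + (exp t - exp s) *\<^sub>R u \<in> K"
      using that assms by (intro cone_add cone_scale) auto
    then show ?thesis
      by (simp add: algebra_simps)
  qed
  then show ?thesis
    using assms by (auto simp: mem_thompson_set)
qed

lemma thompson_dist_less_obtain:
  assumes "thompson_dist K x y < z"
  obtains s where "s \<in> thompson_set K x y" "ereal s < z"
  using assms by (auto simp: thompson_dist_def INF_less_iff)

section \<open>Homogeneity and distances along a ray\<close>

lemma thompson_set_scale:
  assumes "0 < l"
  shows "thompson_set K (l *\<^sub>R x) (l *\<^sub>R y) = thompson_set K x y"
proof -
  have "exp s *\<^sub>R l *\<^sub>R u - l *\<^sub>R v = l *\<^sub>R (exp s *\<^sub>R u - v)" for s :: real and u v :: 'a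
    by (simp add: algebra_simps)
  then show ?thesis
    using assms by (simp add: set_eq_iff mem_thompson_set cone_scale_iff)
qed

lemma thompson_set_ray:
  assumes "x \<in> K" "x \<noteq> 0" "0 < l" "0 < m"
  shows "thompson_set K (l *\<^sub>R x) (m *\<^sub>R x) = {\<bar>ln (l / m)\<bar>..}"
proof -
  \<comment> \<open>The two membership conditions become \<open>ln l - ln m \<le> s\<close> and its
    mirror image; together they bound the absolute value, which absorbs
    \<open>0 \<le> s\<close>.\<close>
  have ray: "(exp s * b) *\<^sub>R x - a *\<^sub>R x \<in> K \<longleftrightarrow> ln a - ln b \<le> s"
    if "0 < a" "0 < b" for a b s :: real
  proof -
    have "(exp s * b) *\<^sub>R x - a *\<^sub>R x = (exp s * b - a) *\<^sub>R x"
      by (simp add: algebra_simps)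
    moreover have "a \<le> exp s * b \<longleftrightarrow> ln a \<le> ln (exp s * b)"
      using that by (subst ln_le_cancel_iff) auto
    ultimately show ?thesis
      using that assms by (auto simp: cone_ray_iff ln_mult)
  qed
  show ?thesis
    using assms by (auto simp: set_eq_iff mem_thompson_set ray ln_div)
qed

lemma thompson_dist_ray:
  assumes "x \<in> K" "x \<noteq> 0" "0 < l" "0 < m"
  shows "thompson_dist K (l *\<^sub>R x) (m *\<^sub>R x) = ereal \<bar>ln (l / m)\<bar>"
  unfolding thompson_dist_def thompson_set_ray[OF assms]
  by (intro antisym INF_lower INF_greatest) auto

lemma thompson_dist_le_ln_max:
  assumes "x \<in> K" "x \<noteq> 0" "0 < l" "0 < m" "m *\<^sub>R x \<le>\<^bsub>K\<^esub> y" "y \<le>\<^bsub>K\<^esub> l *\<^sub>R x"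
  shows "thompson_dist K x y \<le> ereal (ln (max (inverse m) l))"
proof (rule thompson_dist_le)
  define M where "M = max (inverse m) l"
  have y: "y - m *\<^sub>R x \<in> K" "l *\<^sub>R x - y \<in> K"
    using assms by (simp_all add: cone_le_def)
  \<comment> \<open>Elements of \<sigma> are nonnegative, so \<open>1 \<le> M\<close> is required.
    It follows from \<open>m \<le> l\<close>: either \<open>1 \<le> m \<le> l\<close>, or
    \<open>m < 1\<close> and the inverse of \<open>m\<close> exceeds 1.\<close>
  have "(l - m) *\<^sub>R x \<in> K"
    using cone_add[OF y] by (simp add: algebra_simps)
  then have "m \<le> l"
    using assms by (simp add: cone_ray_iff)
  have M: "l \<le> M" "inverse m \<le> M" "0 < M"
    using assms by (auto simp: M_def)
  have Mm: "1 \<le> M * m"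
    using M(2) assms by (simp add: field_simps)
  have "1 \<le> M"
  proof (cases "1 \<le> m")
    case False
    then show ?thesis
      using M(2) one_le_inverse[of m] assms by linarith
  qed (use \<open>m \<le> l\<close> M(1) in linarith)
  \<comment> \<open>The two sums are \<open>M y - x\<close> and \<open>M x - y\<close>, where
    \<open>M\<close> is the exponential of the claimed bound.\<close>
  have "M *\<^sub>R (y - m *\<^sub>R x) + (M * m - 1) *\<^sub>R x \<in> K"
    using y assms M Mm by (intro cone_add cone_scale) auto
  moreover have "(l *\<^sub>R x - y) + (M - l) *\<^sub>R x \<in> K"
    using y assms M by (intro cone_add cone_scale) auto
  ultimately show "ln (max (inverse m) l) \<in> thompson_set K x y"
    using \<open>1 \<le> M\<close> unfolding M_def[symmetric] by (simp add: mem_thompson_set algebra_simps)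
qed

section \<open>Archimedean cones\<close>

lemma archimedean_cone_closed_ray:
  assumes arch: "archimedean_cone K" and "x \<in> K"
    and ray: "\<And>\<delta>::real. 0 < \<delta> \<Longrightarrow> a + \<delta> *\<^sub>R x \<in> K"
  shows "a \<in> K"
proof -
  \<comment> \<open>For positive \<open>n\<close> take \<delta> = 1/n and multiply by
    \<open>n\<close>; for \<open>n = 0\<close> the claim is \<open>x \<in> K\<close>.\<close>
  have "real n *\<^sub>R (- a) \<le>\<^bsub>K\<^esub> x" for n
  proof (cases "n = 0")
    case False
    then have "real n *\<^sub>R (a + inverse (real n) *\<^sub>R x) \<in> K"
      by (intro cone_scale ray) auto
    then show ?thesis
      using False by (simp add: cone_le_def algebra_simps)
  qed (use assms in \<open>simp add: cone_le_def\<close>)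
  then have "- a \<le>\<^bsub>K\<^esub> 0"
    using arch unfolding archimedean_cone_def by blast
  then show ?thesis
    by (simp add: cone_le_def)
qed

lemma archimedean_thompson_set_iff:
  assumes arch: "archimedean_cone K" and "x \<in> K" "y \<in> K"
  shows "s \<in> thompson_set K x y \<longleftrightarrow> 0 \<le> s \<and> thompson_dist K x y \<le> ereal s"
proof
  assume s: "0 \<le> s \<and> thompson_dist K x y \<le> ereal s"
  \<comment> \<open>The infimum itself may be missed by \<sigma>, but every \<open>t > s\<close>
    belongs to it by upward closure; closedness along rays then handles the limit.\<close>
  have above: "t \<in> thompson_set K x y" if t: "s < t" for t
  proof -
    have "thompson_dist K x y < ereal t"
      using s t by (auto intro: le_less_trans)
    then obtain r where "r \<in> thompson_set K x y" "ereal r < ereal t"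
      by (rule thompson_dist_less_obtain)
    then show ?thesis
      using assms thompson_set_upward[of x y r t] by simp
  qed
  have mem: "exp s *\<^sub>R u - v \<in> K"
    if "u \<in> K" and uv: "\<And>t. s < t \<Longrightarrow> exp t *\<^sub>R u - v \<in> K" for u v
  proof (rule archimedean_cone_closed_ray[OF arch \<open>u \<in> K\<close>])
    fix \<delta> :: real
    assume "0 < \<delta>"
    have pos: "0 < exp s + \<delta>"
      using \<open>0 < \<delta>\<close> by (simp add: add_pos_pos)
    \<comment> \<open>With \<open>t = ln (exp s + \<delta>)\<close>, the change of exponent becomes
      exactly the additive term \<open>\<delta> u\<close>.\<close>
    have "s < ln (exp s + \<delta>)"
      using \<open>0 < \<delta>\<close> pos ln_less_cancel_iff[of "exp s" "exp s + \<delta>"] by simp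
    from uv[OF this] show "exp s *\<^sub>R u - v + \<delta> *\<^sub>R u \<in> K"
      using pos by (simp add: algebra_simps)
  qed
  show "s \<in> thompson_set K x y"
    using s above assms by (auto simp: mem_thompson_set intro!: mem)
qed (auto simp: mem_thompson_set intro: thompson_dist_le)

lemma archimedean_thompson_set_mono:
  assumes "archimedean_cone K" "x \<in> K" "y \<in> K" "x' \<in> K" "y' \<in> K"
    and "thompson_dist K x' y' \<le> thompson_dist K x y"
  shows "thompson_set K x y \<subseteq> thompson_set K x' y'"
  using assms by (auto simp: archimedean_thompson_set_iff intro: order_trans)

section \<open>The maximum of two distances\<close>

lemma max_thompson_dist:
  assumes "x \<in> K" "y \<in> K" "x' \<in> K" "y' \<in> K"
  shows "max (thompson_dist K x y) (thompson_dist K x' y') =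
    (INF s\<in>thompson_set K x y \<inter> thompson_set K x' y'. ereal s)" (is "?d = ?i")
proof (rule antisym)
  show "?d \<le> ?i"
    by (auto intro: INF_greatest thompson_dist_le)
  show "?i \<le> ?d"
  proof (rule dense_ge)
    \<comment> \<open>Approximation from above also covers infinite distances, since then no such
      \<open>z\<close> exists. The larger of the two witnesses lies in both sets by upward
      closure.\<close>
    fix z
    assume "?d < z"
    then obtain s s' where s: "s \<in> thompson_set K x y" "ereal s < z"
      and s': "s' \<in> thompson_set K x' y'" "ereal s' < z"
      by (auto elim!: thompson_dist_less_obtain)
    then have "max s s' \<in> thompson_set K x y \<inter> thompson_set K x' y'"
      using assms thompson_set_upward[of x y s "max s s'"]
        thompson_set_upward[of x' y' s' "max s s'"] by simp
    then have "?i \<le> ereal (max s s')"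
      by (rule INF_lower)
    also have "\<dots> \<le> z"
      using s s' by (auto simp: max_def)
    finally show "?i \<le> z" .
  qed
qed

section \<open>Monotonicity and positive combinations\<close>

lemma thompson_dist_add_mono:
  assumes "x \<in> K" "x' \<in> K" "y' \<in> K" "x \<le>\<^bsub>K\<^esub> x'" "y' \<le>\<^bsub>K\<^esub> y"
  shows "thompson_dist K x' (x' + y') \<le> thompson_dist K x (x + y)"
proof (rule thompson_dist_mono, rule subsetI)
  fix s
  assume "s \<in> thompson_set K x (x + y)"
  then have s: "0 \<le> s" "exp s *\<^sub>R x - (x + y) \<in> K"
    by (auto simp: mem_thompson_set)
  \<comment> \<open>One condition holds for every \<open>s \<ge> 0\<close>. The other,
    \<open>(exp s - 1) x' - y' \<in> K\<close>, improves as \<open>x'\<close> grows and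
    \<open>y'\<close> shrinks.\<close>
  have "(exp s - 1) *\<^sub>R x' + exp s *\<^sub>R y' \<in> K"
    using s assms by (intro cone_add cone_scale) auto
  moreover have "(exp s *\<^sub>R x - (x + y)) + (exp s - 1) *\<^sub>R (x' - x) + (y - y') \<in> K"
    using s assms by (intro cone_add cone_scale) (auto simp: cone_le_def)
  ultimately show "s \<in> thompson_set K x' (x' + y')"
    using s by (simp add: mem_thompson_set algebra_simps)
qed

lemma thompson_dist_interval_mono:
  assumes "x' \<in> K" "x \<le>\<^bsub>K\<^esub> x'" "x' \<le>\<^bsub>K\<^esub> y'" "y' \<le>\<^bsub>K\<^esub> y"
  shows "thompson_dist K x' y' \<le> thompson_dist K x y"
proof (rule thompson_dist_mono, rule subsetI)
  fix s
  assume "s \<in> thompson_set K x y"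
  then have s: "0 \<le> s" "exp s *\<^sub>R x - y \<in> K"
    by (auto simp: mem_thompson_set)
  \<comment> \<open>Since \<open>x'\<close> lies below \<open>y'\<close>, this condition needs only
    \<open>s \<ge> 0\<close>; the hypothesis on \<open>s\<close> serves the other one.\<close>
  have "exp s *\<^sub>R (y' - x') + (exp s - 1) *\<^sub>R x' \<in> K"
    using s assms by (intro cone_add cone_scale) (auto simp: cone_le_def)
  moreover have "(exp s *\<^sub>R x - y) + exp s *\<^sub>R (x' - x) + (y - y') \<in> K"
    using s assms by (intro cone_add cone_scale) (auto simp: cone_le_def)
  ultimately show "s \<in> thompson_set K x' y'"
    using s by (simp add: mem_thompson_set algebra_simps)
qed

lemma thompson_dist_combination:
  assumes "x \<in> K" "y \<in> K" "x' \<in> K" "y' \<in> K" "0 < l" "0 < m"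
  shows "thompson_dist K (l *\<^sub>R x + m *\<^sub>R y) (l *\<^sub>R x' + m *\<^sub>R y') \<le>
    max (thompson_dist K x x') (thompson_dist K y y')"
  \<comment> \<open>The infimum over the intersection supplies one \<open>s\<close> valid for both
    pairs, and the conditions on it are linear in the pair.\<close>
  unfolding max_thompson_dist[OF assms(1,3,2,4)]
proof (rule INF_greatest, rule thompson_dist_le)
  fix s
  assume s: "s \<in> thompson_set K x x' \<inter> thompson_set K y y'"
  have "l *\<^sub>R (exp s *\<^sub>R x' - x) + m *\<^sub>R (exp s *\<^sub>R y' - y) \<in> K"
    "l *\<^sub>R (exp s *\<^sub>R x - x') + m *\<^sub>R (exp s *\<^sub>R y - y') \<in> K"
    using s assms by (auto simp: mem_thompson_set intro!: cone_add cone_scale)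
  then show "s \<in> thompson_set K (l *\<^sub>R x + m *\<^sub>R y) (l *\<^sub>R x' + m *\<^sub>R y')"
    using s by (simp add: mem_thompson_set algebra_simps)
qed

end

theorem proposition3p10:
  fixes K :: "'a::real_vector set"
  assumes "ordering_cone K"
  shows
   "(\<comment> \<open>1 (i)\<close>
     \<forall>x\<in>K. \<forall>y\<in>K. \<forall>l>0.
       thompson_set K (l *\<^sub>R x) (l *\<^sub>R y) = thompson_set K x y \<and>
       thompson_dist K (l *\<^sub>R x) (l *\<^sub>R y) = thompson_dist K x y) \<and>
    (\<comment> \<open>1 (ii); the identities fail for \<open>x = 0\<close> and \<open>l \<noteq> m\<close>\<close>
     \<forall>x\<in>K. \<forall>l>0. \<forall>m>0. x \<noteq> 0 \<longrightarrow>
       thompson_set K (l *\<^sub>R x) (m *\<^sub>R x) = {\<bar>ln (l / m)\<bar>..} \<and>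
       thompson_dist K (l *\<^sub>R x) (m *\<^sub>R x) = ereal \<bar>ln (l / m)\<bar>) \<and>
    (\<comment> \<open>1 (iii); the inequality fails for \<open>x = y = 0\<close> and \<open>l < 1 < m\<close>\<close>
     \<forall>x\<in>K. \<forall>y\<in>K. \<forall>l>0. \<forall>m>0. x \<noteq> 0 \<longrightarrow>
       m *\<^sub>R x \<le>\<^bsub>K\<^esub> y \<and> y \<le>\<^bsub>K\<^esub> l *\<^sub>R x \<longrightarrow>
       thompson_dist K x y \<le> ereal (ln (max (inverse m) l))) \<and>
    (\<comment> \<open>2\<close>
     \<forall>x\<in>K. \<forall>y\<in>K. \<forall>x'\<in>K. \<forall>y'\<in>K.
       thompson_set K x y \<subseteq> thompson_set K x' y' \<longrightarrow>
       thompson_dist K x y \<ge> thompson_dist K x' y') \<and>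
    (archimedean_cone K \<longrightarrow>
       (\<forall>x\<in>K. \<forall>y\<in>K. \<forall>x'\<in>K. \<forall>y'\<in>K.
          thompson_dist K x y \<ge> thompson_dist K x' y' \<longrightarrow>
          thompson_set K x y \<subseteq> thompson_set K x' y')) \<and>
    (\<forall>x\<in>K. \<forall>y\<in>K. \<forall>x'\<in>K. \<forall>y'\<in>K.
       max (thompson_dist K x y) (thompson_dist K x' y') =
       (INF s\<in>thompson_set K x y \<inter> thompson_set K x' y'. ereal s)) \<and>
    (\<comment> \<open>3 (i)\<close>
     \<forall>x\<in>K. \<forall>y\<in>K. \<forall>x'\<in>K. \<forall>y'\<in>K.
       x \<le>\<^bsub>K\<^esub> x' \<and> y' \<le>\<^bsub>K\<^esub> y \<longrightarrow>
       thompson_dist K x' (x' + y') \<le> thompson_dist K x (x + y)) \<and>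
    (\<comment> \<open>3 (ii)\<close>
     \<forall>x\<in>K. \<forall>y\<in>K. \<forall>x'\<in>K. \<forall>y'\<in>K.
       x \<le>\<^bsub>K\<^esub> x' \<and> x' \<le>\<^bsub>K\<^esub> y' \<and> y' \<le>\<^bsub>K\<^esub> y \<longrightarrow>
       thompson_dist K x' y' \<le> thompson_dist K x y) \<and>
    (\<comment> \<open>4\<close>
     \<forall>x\<in>K. \<forall>y\<in>K. \<forall>x'\<in>K. \<forall>y'\<in>K. \<forall>l>0. \<forall>m>0.
       thompson_dist K (l *\<^sub>R x + m *\<^sub>R y) (l *\<^sub>R x' + m *\<^sub>R y') \<le>
       max (thompson_dist K x x') (thompson_dist K y y'))"
proof (intro conjI ballI allI impI, goal_cases)
  case 1
  with assms show ?case by (simp add: thompson_set_scale)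
next
  case 2
  with assms show ?case by (simp add: thompson_dist_def thompson_set_scale)
next
  case 3
  with assms show ?case by (simp add: thompson_set_ray)
next
  case 4
  with assms show ?case by (simp add: thompson_dist_ray)
next
  case 5
  with assms show ?case by (blast intro: thompson_dist_le_ln_max)
next
  case 6
  then show ?case by (blast intro: thompson_dist_mono)
next
  case 7
  with assms show ?case by (intro archimedean_thompson_set_mono)
next
  case 8
  with assms show ?case by (intro max_thompson_dist)
next
  case 9
  with assms show ?case by (blast intro: thompson_dist_add_mono)
next
  case 10
  with assms show ?case by (blast intro: thompson_dist_interval_mono)
next
  case 11
  with assms show ?case by (intro thompson_dist_combination)
qed

end
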